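(* Let $H\in\mathcal{H}$ and let $k_1,k_2$ be integers with $3\le k_1\le k_2$. If $K_{1,k_1}\le H$ and $H\le K_{1,k_2}$, then $H=K_{1,k}$ or $H=K^+_{1,k}$ for some integer $k$ with $k_1\le k\le k_2$.
   Context: All graphs are finite and simple, considered up to isomorphism (equalities between graphs mean isomorphism). An edge-colored graph is a pair $(G,c)$ with $c\colon E(G)\to\mathbb{N}$ an arbitrary map (not necessarily proper); it is colored in $t$ or more colors if $|c(E(G))|\ge t$. A subgraph (not necessarily induced) is rainbow if its edges receive pairwise distinct colors. $(G,c)$ is rainbow $H$-free if $G$ contains no rainbow subgraph isomorphic to $H$. For graphs $H_1,H_2$, write $H_1\le H_2$ if there is a positive integer $t$ such that every rainbow $H_1$-free edge-colored complete graph colored in $t$ or more colors is rainbow $H_2$-free. $\mathcal{H}$ denotes the set of connected finite simple graphs other than the paths $P_1,P_2,P_3,P_4$ ($P_k$ is the path on $k$ vertices). $K_{1,k}$ is the star with $k$ leaves, and $K^+_{1,k}$ is obtained from $K_{1,k}$ by subdividing one edge with one new vertex. *)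

theory Defs
  imports Main
begin

record 'a graph =
  verts :: "'a set"
  edges :: "'a set set"

definition simple_graph :: "'a graph \<Rightarrow> bool" where
  "simple_graph G \<longleftrightarrow> finite (verts G) \<and> (\<forall>e\<in>edges G. e \<subseteq> verts G \<and> card e = 2)"

definition subgraph :: "'a graph \<Rightarrow> 'a graph \<Rightarrow> bool" where
  "subgraph S G \<longleftrightarrow> simple_graph S \<and> verts S \<subseteq> verts G \<and> edges S \<subseteq> edges G"

definition graph_iso :: "'a graph \<Rightarrow> 'b graph \<Rightarrow> bool" (infix "\<cong>\<^sub>g" 50) where
  "G \<cong>\<^sub>g G' \<longleftrightarrow> (\<exists>f. bij_betw f (verts G) (verts G') \<and> (\<lambda>e. f ` e) ` edges G = edges G')"

text \<open>Connected graphs are nonempty by convention.\<close>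

definition connected_graph :: "'a graph \<Rightarrow> bool" where
  "connected_graph G \<longleftrightarrow> verts G \<noteq> {} \<and>
     (\<forall>u\<in>verts G. \<forall>v\<in>verts G. (u, v) \<in> {(x, y). {x, y} \<in> edges G}\<^sup>*)"

definition complete_graph :: "'a set \<Rightarrow> 'a graph" where
  "complete_graph V = \<lparr>verts = V, edges = {e. e \<subseteq> V \<and> card e = 2}\<rparr>"

definition path_graph :: "nat \<Rightarrow> nat graph" where
  "path_graph k = \<lparr>verts = {1..k}, edges = {{i, Suc i} | i. 1 \<le> i \<and> i < k}\<rparr>"

text \<open>The star \<open>K\<^bsub>1,k\<^esub>\<close> with centre \<open>0\<close> and leaves \<open>1, \<dots>, k\<close>.\<close>

definition star_graph :: "nat \<Rightarrow> nat graph" where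
  "star_graph k = \<lparr>verts = {0..k}, edges = {{0, i} | i. 1 \<le> i \<and> i \<le> k}\<rparr>"

definition subdivide_edge :: "'a graph \<Rightarrow> 'a \<Rightarrow> 'a \<Rightarrow> 'a \<Rightarrow> 'a graph" where
  "subdivide_edge G u v w =
     \<lparr>verts = insert w (verts G), edges = (edges G - {{u, v}}) \<union> {{u, w}, {w, v}}\<rparr>"

text \<open>\<open>K\<^sup>+\<^bsub>1,k\<^esub>\<close>, meaningful for \<open>k \<ge> 1\<close>: the edge between \<open>0\<close> and \<open>1\<close> is subdivided
  by the new vertex \<open>k + 1\<close>.\<close>

definition star_plus_graph :: "nat \<Rightarrow> nat graph" where
  "star_plus_graph k = subdivide_edge (star_graph k) 0 1 (Suc k)"

definition rainbow :: "'a graph \<Rightarrow> ('a set \<Rightarrow> nat) \<Rightarrow> bool" where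
  "rainbow G c \<longleftrightarrow> inj_on c (edges G)"

definition rainbow_free :: "'b graph \<Rightarrow> 'a graph \<Rightarrow> ('a set \<Rightarrow> nat) \<Rightarrow> bool" where
  "rainbow_free H G c \<longleftrightarrow> \<not> (\<exists>S. subgraph S G \<and> S \<cong>\<^sub>g H \<and> rainbow S c)"

text \<open>Up to isomorphism, every finite complete graph has a set of natural numbers as its vertex
  set, so it suffices to quantify over those. Values of \<open>c\<close> outside the edge set are irrelevant.\<close>

definition rainbow_le :: "'a graph \<Rightarrow> 'b graph \<Rightarrow> bool" (infix "\<le>\<^sub>r" 50) where
  "H1 \<le>\<^sub>r H2 \<longleftrightarrow>
     (\<exists>t\<ge>1. \<forall>(V :: nat set) (c :: nat set \<Rightarrow> nat).
        finite V \<and> t \<le> card (c ` edges (complete_graph V)) \<and>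
        rainbow_free H1 (complete_graph V) c \<longrightarrow>
        rainbow_free H2 (complete_graph V) c)"

definition in_H :: "'a graph \<Rightarrow> bool" where
  "in_H G \<longleftrightarrow> simple_graph G \<and> connected_graph G \<and> (\<forall>k\<in>{1..4}. \<not> G \<cong>\<^sub>g path_graph k)"

end

theory Submission
  imports Defs
begin

text \<open>
  Colour the edges at a vertex \<open>0\<close> distinctly and all other edges alike: a connected rainbow subgraph
  is then a star, a subdivided star, or contains a triangle. Colouring each edge by its larger
  endpoint leaves no rainbow triangle, so \<open>H\<close> is \<open>K\<^bsub>1,k\<^esub>\<close> or \<open>K\<^sup>+\<^bsub>1,k\<^esub>\<close>. Finally, take a rainbow star with
  \<open>k - 1\<close> edges, add a disjoint rainbow matching to obtain many colours, and give all remaining edges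
  one further colour. The centre sees \<open>k\<close> colours and every other vertex at most two, which bounds
  \<open>k\<close> from both sides.
\<close>

section \<open>Isomorphism\<close>

lemma simple_graph_edgeE:
  assumes "simple_graph G" "e \<in> edges G"
  obtains x y where "e = {x, y}" "x \<noteq> y" "x \<in> verts G" "y \<in> verts G"
  using assms unfolding simple_graph_def by (metis card_2_iff insert_subset)

lemma simple_graph_finite_edges:
  assumes "simple_graph G"
  shows "finite (edges G)"
  using assms unfolding simple_graph_def
  by (metis Pow_iff finite_Pow_iff finite_subset subsetI)

lemma graph_iso_refl: "G \<cong>\<^sub>g G"
  unfolding graph_iso_def by (rule exI[of _ id]) auto

lemma graph_iso_sym:
  assumes "G \<cong>\<^sub>g G'" "simple_graph G"
  shows "G' \<cong>\<^sub>g G"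
proof -
  obtain f where f: "bij_betw f (verts G) (verts G')" "(\<lambda>e. f ` e) ` edges G = edges G'"
    using assms(1) unfolding graph_iso_def by blast
  have inv: "inv_into (verts G) f ` f ` e = e" if "e \<in> edges G" for e
    using that assms(2) f(1) unfolding simple_graph_def
    by (meson bij_betw_imp_inj_on inv_into_image_cancel)
  have "(\<lambda>e. inv_into (verts G) f ` e) ` edges G' = (\<lambda>e. e) ` edges G"
    unfolding f(2)[symmetric] image_image using inv by (intro image_cong) auto
  then show ?thesis
    unfolding graph_iso_def using bij_betw_inv_into[OF f(1)] by auto
qed

lemma graph_iso_trans:
  assumes "G \<cong>\<^sub>g G'" "G' \<cong>\<^sub>g G''"
  shows "G \<cong>\<^sub>g G''"
proof -
  obtain f where f: "bij_betw f (verts G) (verts G')" "(\<lambda>e. f ` e) ` edges G = edges G'"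
    using assms(1) unfolding graph_iso_def by blast
  obtain g where g: "bij_betw g (verts G') (verts G'')" "(\<lambda>e. g ` e) ` edges G' = edges G''"
    using assms(2) unfolding graph_iso_def by blast
  have "(\<lambda>e. (g \<circ> f) ` e) ` edges G = edges G''"
    unfolding g(2)[symmetric] f(2)[symmetric] by (simp add: image_image comp_def)
  then show ?thesis
    unfolding graph_iso_def using bij_betw_trans[OF f(1) g(1)] by blast
qed

lemma graph_iso_connected:
  assumes "G \<cong>\<^sub>g G'" "connected_graph G"
  shows "connected_graph G'"
proof -
  obtain f where f: "bij_betw f (verts G) (verts G')" "(\<lambda>e. f ` e) ` edges G = edges G'"
    using assms(1) unfolding graph_iso_def by blast
  have "(f u, f v) \<in> {(x, y). {x, y} \<in> edges G'}\<^sup>*"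
    if "(u, v) \<in> {(x, y). {x, y} \<in> edges G}\<^sup>*" for u v
    using that
  proof induction
    case (step y z)
    have "f ` {y, z} \<in> edges G'"
      using step(2) unfolding f(2)[symmetric] by blast
    then show ?case using step(3) by (auto intro: rtrancl_into_rtrancl)
  qed simp
  then have "(f u, f v) \<in> {(x, y). {x, y} \<in> edges G'}\<^sup>*"
    if "u \<in> verts G" "v \<in> verts G" for u v
    using assms(2) that unfolding connected_graph_def by blast
  moreover have "verts G' = f ` verts G" "verts G \<noteq> {}"
    using f(1) assms(2) by (simp_all add: bij_betw_def connected_graph_def)
  ultimately show ?thesis unfolding connected_graph_def by simp
qed

definition has_triangle :: "'a graph \<Rightarrow> bool" where
  "has_triangle G \<longleftrightarrow> (\<exists>x y z. x \<noteq> y \<and> y \<noteq> z \<and> x \<noteq> z \<and>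
     {x, y} \<in> edges G \<and> {y, z} \<in> edges G \<and> {x, z} \<in> edges G)"

lemma graph_iso_has_triangle:
  assumes "G \<cong>\<^sub>g G'" "simple_graph G" "has_triangle G"
  shows "has_triangle G'"
proof -
  obtain f where f: "bij_betw f (verts G) (verts G')" "(\<lambda>e. f ` e) ` edges G = edges G'"
    using assms(1) unfolding graph_iso_def by blast
  obtain x y z where xyz: "x \<noteq> y" "y \<noteq> z" "x \<noteq> z"
    "{x, y} \<in> edges G" "{y, z} \<in> edges G" "{x, z} \<in> edges G"
    using assms(3) unfolding has_triangle_def by blast
  have "x \<in> verts G" "y \<in> verts G" "z \<in> verts G"
    using xyz assms(2) unfolding simple_graph_def by auto
  then have "f x \<noteq> f y" "f y \<noteq> f z" "f x \<noteq> f z"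
    using xyz f(1) unfolding bij_betw_def inj_on_def by auto
  moreover have "f ` {x, y} \<in> edges G'" "f ` {y, z} \<in> edges G'" "f ` {x, z} \<in> edges G'"
    using xyz unfolding f(2)[symmetric] by blast+
  ultimately show ?thesis unfolding has_triangle_def by auto
qed

text \<open>The preimage \<open>v\<close> of \<open>w\<close> works: every edge at \<open>w\<close>
  is the image of an edge at \<open>v\<close>. This direction suffices for bounding degrees of a
  rainbow copy from below.\<close>

lemma graph_iso_degree_le:
  assumes "G \<cong>\<^sub>g G'" "simple_graph G" "w \<in> verts G'"
  shows "\<exists>v\<in>verts G. card {e \<in> edges G'. w \<in> e} \<le> card {e \<in> edges G. v \<in> e}"
proof -
  obtain f where f: "bij_betw f (verts G) (verts G')" "(\<lambda>e. f ` e) ` edges G = edges G'"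
    using assms(1) unfolding graph_iso_def by blast
  obtain v where v: "v \<in> verts G" "f v = w"
    using assms(3) by (auto simp flip: bij_betw_imp_surj_on[OF f(1)])
  have "{e \<in> edges G'. w \<in> e} \<subseteq> (\<lambda>e. f ` e) ` {e \<in> edges G. v \<in> e}"
  proof
    fix e' assume "e' \<in> {e \<in> edges G'. w \<in> e}"
    then obtain e where e: "e \<in> edges G" "e' = f ` e" "w \<in> f ` e"
      unfolding f(2)[symmetric] by blast
    then obtain x where x: "x \<in> e" "f x = f v" using v(2) by auto
    have "x \<in> verts G" using x(1) e(1) assms(2) unfolding simple_graph_def by blast
    then have "x = v" using x(2) v(1) bij_betw_imp_inj_on[OF f(1)] by (simp add: inj_on_eq_iff)
    then show "e' \<in> (\<lambda>e. f ` e) ` {e \<in> edges G. v \<in> e}"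
      using e(1) x(1) unfolding e(2) by simp
  qed
  then have "card {e \<in> edges G'. w \<in> e} \<le> card {e \<in> edges G. v \<in> e}"
    by (rule surj_card_le[rotated]) (simp add: simple_graph_finite_edges[OF assms(2)])
  then show ?thesis using v(1) by blast
qed

section \<open>Stars and subdivided stars\<close>

lemma star_graph_edges: "edges (star_graph k) = (\<lambda>i. {0, i}) ` {1..k}"
  unfolding star_graph_def by auto

text \<open>The new vertex \<open>Suc k\<close> replaces the leaf \<open>1\<close> as a neighbour of
  the centre, and \<open>1\<close> hangs off it. For k = 0 there would be no edge to subdivide and
  the new vertex would coincide with \<open>1\<close>.\<close>

lemma star_plus_graph_edges:
  assumes "1 \<le> k"
  shows "edges (star_plus_graph k) = (\<lambda>i. {0, i}) ` {2..Suc k} \<union> {{Suc k, 1}}"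
proof -
  have "{1..k} = insert 1 {2..k}"
    using assms by auto
  moreover have "{0, 1} \<notin> (\<lambda>i::nat. {0, i}) ` {2..k}"
    by (simp add: image_iff doubleton_eq_iff)
  ultimately have "(\<lambda>i. {0, i}) ` {1..k} - {{0, 1}} = (\<lambda>i. {0, i}) ` {2..k}"
    by simp
  moreover have "{2..Suc k} = insert (Suc k) {2..k}"
    using assms by auto
  ultimately show ?thesis
    unfolding star_plus_graph_def subdivide_edge_def by (simp add: star_graph_edges insert_commute)
qed

lemma star_plus_graph_verts: "verts (star_plus_graph k) = {0..Suc k}"
  unfolding star_plus_graph_def subdivide_edge_def star_graph_def by auto

lemma star_graph_degree: "card {e \<in> edges (star_graph k). 0 \<in> e} = k"
proof -
  have "{e \<in> edges (star_graph k). 0 \<in> e} = (\<lambda>i. {0, i}) ` {1..k}"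
    by (auto simp: star_graph_edges)
  moreover have "inj_on (\<lambda>i. {0, i}) {1..k}"
    by (auto simp: inj_on_def doubleton_eq_iff)
  ultimately show ?thesis by (simp add: card_image)
qed

lemma star_plus_graph_degree:
  assumes "1 \<le> k"
  shows "card {e \<in> edges (star_plus_graph k). 0 \<in> e} = k"
proof -
  have "{e \<in> edges (star_plus_graph k). 0 \<in> e} = (\<lambda>i. {0, i}) ` {2..Suc k}"
    by (auto simp: star_plus_graph_edges[OF assms])
  moreover have "inj_on (\<lambda>i. {0, i}) {2..Suc k}"
    by (auto simp: inj_on_def doubleton_eq_iff)
  ultimately show ?thesis by (simp add: card_image)
qed

lemma iso_star_graphI:
  assumes "finite (verts G)" "u \<in> verts G"
    and "edges G = (\<lambda>x. {u, x}) ` (verts G - {u})"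
  shows "\<exists>k. G \<cong>\<^sub>g star_graph k"
proof -
  define k where "k = card (verts G - {u})"
  have "card (verts G - {u}) = card {1..k}" by (simp add: k_def)
  then obtain g where g: "bij_betw g (verts G - {u}) {1..k}"
    using finite_same_card_bij[OF finite_Diff[OF assms(1)] finite_atLeastAtMost] by blast
  define f where "f = g(u := 0)"
  have fg: "bij_betw f (verts G - {u}) {1..k}" "f u = 0"
    using g by (subst bij_betw_cong[of _ _ g]) (auto simp: f_def)
  have "bij_betw f (verts G - {u} \<union> {u}) ({1..k} \<union> {f u})"
    using fg by (intro notIn_Un_bij_betw) auto
  moreover have "verts G - {u} \<union> {u} = verts G" "{1..k} \<union> {f u} = verts (star_graph k)"
    using assms(2) fg(2) by (auto simp: star_graph_def)
  ultimately have "bij_betw f (verts G) (verts (star_graph k))" by simp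
  moreover have "(\<lambda>e. f ` e) ` edges G = edges (star_graph k)"
  proof -
    have "(\<lambda>e. f ` e) ` edges G = (\<lambda>x. {0, x}) ` f ` (verts G - {u})"
      by (simp add: assms(3) image_image fg(2))
    then show ?thesis using fg(1) by (simp add: star_graph_edges bij_betw_def)
  qed
  ultimately show ?thesis unfolding graph_iso_def by blast
qed

text \<open>Here \<open>u\<close> is the centre, \<open>a\<close> the subdividing vertex and
  \<open>b\<close> the end beyond it. The parameter is forced, since a subdivided star with k
  original leaves has k + 2 vertices.\<close>

lemma iso_star_plus_graphI:
  assumes "finite (verts G)" "u \<in> verts G" "a \<in> verts G" "b \<in> verts G"
    and "u \<noteq> a" "u \<noteq> b" "a \<noteq> b"
    and "edges G = (\<lambda>x. {u, x}) ` (verts G - {u, b}) \<union> {{a, b}}"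
  shows "G \<cong>\<^sub>g star_plus_graph (card (verts G) - 2)"
proof -
  define W where "W = verts G - {u, a, b}"
  define k where "k = card (verts G) - 2"
  have V: "verts G = insert u (insert a (insert b W))" "u \<notin> W" "a \<notin> W" "b \<notin> W" "finite W"
    using assms by (auto simp: W_def)
  then have cW: "k = Suc (card W)" using assms by (simp add: k_def)
  have "card W = card {2..k}" by (simp add: cW)
  then obtain g where g: "bij_betw g W {2..k}"
    using finite_same_card_bij[OF V(5) finite_atLeastAtMost] by blast
  \<comment> \<open>The labels follow \<open>star_plus_graph\<close>: \<open>Suc k\<close> is its
    subdividing vertex and \<open>1\<close> the leaf cut off from the centre; the other leaves fill
    \<open>{2..k}\<close>.\<close>
  define f where "f = g(u := 0, a := Suc k, b := 1)"
  have f: "f u = 0" "f a = Suc k" "f b = 1" using assms by (auto simp: f_def)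
  have fW: "bij_betw f W {2..k}"
    using g V by (subst bij_betw_cong[of _ _ g]) (auto simp: f_def)
  have img: "f ` W = {2..k}" and inj: "inj_on f W" using fW by (auto simp: bij_betw_def)
  have "inj_on f (verts G)"
    unfolding V(1) using f img inj V cW assms(5-7) by auto
  moreover have "f ` verts G = verts (star_plus_graph k)"
    unfolding V(1) star_plus_graph_verts using f img cW by auto
  ultimately have "bij_betw f (verts G) (verts (star_plus_graph k))" by (simp add: bij_betw_def)
  moreover have "(\<lambda>e. f ` e) ` edges G = edges (star_plus_graph k)"
  proof -
    have "verts G - {u, b} = insert a W" using V assms by auto
    then have "(\<lambda>e. f ` e) ` edges G = (\<lambda>x. {0, x}) ` f ` insert a W \<union> {{Suc k, 1}}"
      by (simp add: assms(8) image_image f)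
    moreover have "f ` insert a W = {2..Suc k}" using img f cW by auto
    moreover have "1 \<le> k" by (simp add: cW)
    ultimately show ?thesis by (simp only: star_plus_graph_edges)
  qed
  ultimately show ?thesis unfolding graph_iso_def k_def by blast
qed

section \<open>Connected graphs with at most one edge off a vertex\<close>

lemma connected_graph_closed:
  assumes "connected_graph G" "a \<in> A" "a \<in> verts G"
    and "\<And>x y. x \<in> A \<Longrightarrow> {x, y} \<in> edges G \<Longrightarrow> y \<in> A"
  shows "verts G \<subseteq> A"
proof
  fix v assume "v \<in> verts G"
  then have "(a, v) \<in> {(x, y). {x, y} \<in> edges G}\<^sup>*"
    using assms unfolding connected_graph_def by blast
  then show "v \<in> A"
    by induction (use assms in auto)
qed

lemma connected_graph_neighbour:
  assumes "connected_graph G" "v \<in> verts G" "w \<in> verts G" "v \<noteq> w"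
  obtains x where "{v, x} \<in> edges G"
  using connected_graph_closed[of G v "{v}"] assms by blast

lemma connected_edges_at_vertex_iso_star:
  assumes "connected_graph G" "simple_graph G" "u \<in> verts G" "\<forall>e\<in>edges G. u \<in> e"
  shows "\<exists>k. G \<cong>\<^sub>g star_graph k"
proof (rule iso_star_graphI[where u = u])
  show "edges G = (\<lambda>x. {u, x}) ` (verts G - {u})"
  proof (intro equalityI subsetI)
    fix e assume e: "e \<in> edges G"
    then obtain x y where "e = {x, y}" "x \<noteq> y" "x \<in> verts G" "y \<in> verts G"
      using simple_graph_edgeE[OF assms(2)] by metis
    then show "e \<in> (\<lambda>x. {u, x}) ` (verts G - {u})"
      using assms(4) e by (auto simp: insert_commute)
  next
    fix e assume "e \<in> (\<lambda>x. {u, x}) ` (verts G - {u})"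
    then obtain v where v: "e = {u, v}" "v \<in> verts G" "v \<noteq> u" by blast
    then obtain x where "{v, x} \<in> edges G"
      using connected_graph_neighbour[OF assms(1), of v u] assms(3) by metis
    then show "e \<in> edges G"
      using assms(4) v by (auto simp: insert_commute)
  qed
qed (use assms in \<open>auto simp: simple_graph_def\<close>)

text \<open>Connectivity ties the only edge ab avoiding u to u, say through a, and every vertex
  outside {u, a, b} must be adjacent to u. What remains open is whether ub is an edge: if so, u, a,
  b form a triangle, otherwise the graph is a subdivided star.\<close>

lemma connected_one_edge_off_vertex:
  assumes G: "connected_graph G" "simple_graph G"
    and off: "\<And>e e'. \<lbrakk>e \<in> edges G; e' \<in> edges G; u \<notin> e; u \<notin> e'\<rbrakk> \<Longrightarrow> e = e'"
  shows "(\<exists>k. G \<cong>\<^sub>g star_graph k) \<or> (\<exists>k\<ge>1. G \<cong>\<^sub>g star_plus_graph k) \<or> has_triangle G"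
proof (cases "u \<in> verts G")
  case False
  \<comment> \<open>If \<open>u\<close> is not a vertex, every edge avoids it, so there is at most
    one edge. By connectivity that edge contains any chosen vertex, and the graph is a star with at
    most one leaf.\<close>
  then have one: "e = e'" if "e \<in> edges G" "e' \<in> edges G" for e e'
    using off[OF that] that G(2) unfolding simple_graph_def by blast
  obtain v where v: "v \<in> verts G" using G(1) unfolding connected_graph_def by blast
  have "v \<in> e" if e: "e \<in> edges G" for e
  proof (rule ccontr)
    assume "v \<notin> e"
    moreover obtain x y where "e = {x, y}" "x \<in> verts G"
      using simple_graph_edgeE[OF G(2) e] by metis
    ultimately obtain z where "{v, z} \<in> edges G"
      using connected_graph_neighbour[OF G(1) v, of x] by blast
    then show False using one[OF e] \<open>v \<notin> e\<close> by blast
  qed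
  then show ?thesis using connected_edges_at_vertex_iso_star[OF G v] by blast
next
  case u: True
  show ?thesis
  proof (cases "\<forall>e\<in>edges G. u \<in> e")
    case True
    then show ?thesis using connected_edges_at_vertex_iso_star[OF G u] by blast
  next
    case False
    then obtain e where e: "e \<in> edges G" "u \<notin> e" by blast
    obtain p q where pq: "e = {p, q}" "p \<noteq> q" "p \<in> verts G" "q \<in> verts G"
      using simple_graph_edgeE[OF G(2) e(1)] by metis
    \<comment> \<open>As \<open>u\<close> lies outside \<open>{p, q}\<close>, some edge leaves this
      set. It differs from \<open>e\<close>, so it passes through \<open>u\<close>.\<close>
    have "\<not> verts G \<subseteq> {p, q}" using u e pq by blast
    then obtain x y where "x \<in> {p, q}" "{x, y} \<in> edges G" "y \<notin> {p, q}"
      using connected_graph_closed[OF G(1), of p "{p, q}"] pq(3) by blast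
    moreover from this have "u = y" using off[OF _ e(1), of "{x, y}"] e(2) pq(1) by blast
    \<comment> \<open>Rename the ends of \<open>e\<close> so that \<open>a\<close> is one adjacent
      to \<open>u\<close>.\<close>
    ultimately obtain a b where ab: "e = {a, b}" "a \<noteq> b" "a \<in> verts G" "b \<in> verts G"
      "{u, a} \<in> edges G"
      using pq by (metis insert_commute insertE singletonD)
    have uab: "u \<noteq> a" "u \<noteq> b" using e(2) ab(1) by auto
    show ?thesis
    proof (cases "{u, b} \<in> edges G")
      case True
      then have "has_triangle G" unfolding has_triangle_def
        using ab e(1) uab by metis
      then show ?thesis by blast
    next
      case False
      have "edges G = (\<lambda>x. {u, x}) ` (verts G - {u, b}) \<union> {{a, b}}"
      proof (intro equalityI subsetI)
        fix e' assume e': "e' \<in> edges G"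
        show "e' \<in> (\<lambda>x. {u, x}) ` (verts G - {u, b}) \<union> {{a, b}}"
        proof (cases "u \<in> e'")
          case True
          then obtain x where "e' = {u, x}" "x \<noteq> u" "x \<in> verts G"
            using simple_graph_edgeE[OF G(2) e'] by (metis insertE insert_commute singletonD)
          then show ?thesis using False e' by auto
        qed (use off e e' ab(1) in blast)
      next
        fix e' assume "e' \<in> (\<lambda>x. {u, x}) ` (verts G - {u, b}) \<union> {{a, b}}"
        then consider "e' = {a, b}" | "e' = {u, a}"
          | v where "e' = {u, v}" "v \<in> verts G" "v \<notin> {u, a, b}" by blast
        then show "e' \<in> edges G"
        proof cases
          case 3
          \<comment> \<open>Any edge at \<open>v\<close> must contain \<open>u\<close>: otherwise it
            would be \<open>e\<close>, which misses \<open>v\<close>.\<close>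
          then obtain x where x: "{v, x} \<in> edges G"
            using connected_graph_neighbour[OF G(1), of v u] u by blast
          then have "u \<in> {v, x}" using off[OF _ e(1) _ e(2), of "{v, x}"] ab(1) 3 by blast
          then show ?thesis using x 3 by (auto simp: insert_commute)
        qed (use e ab in auto)
      qed
      then have "G \<cong>\<^sub>g star_plus_graph (card (verts G) - 2)"
        using iso_star_plus_graphI[of G u a b] G(2) u ab uab unfolding simple_graph_def by blast
      moreover have "card {u, a, b} \<le> card (verts G)"
        using G(2) u ab unfolding simple_graph_def by (intro card_mono) auto
      then have "1 \<le> card (verts G) - 2" using ab(2) uab by simp
      ultimately show ?thesis by blast
    qed
  qed
qed

section \<open>Rainbow copies in edge-coloured complete graphs\<close>

text \<open>The relation only concerns colourings with at least some unknown number of colours. A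
  family of hosts with arbitrarily many colours contains one beyond that threshold, and there the
  contrapositive applies.\<close>

lemma rainbow_le_transfer:
  fixes V :: "nat \<Rightarrow> nat set"
  assumes "H1 \<le>\<^sub>r H2"
    and "\<And>t. finite (V t)" "\<And>t. t \<le> card (c ` edges (complete_graph (V t)))"
    and "\<And>t. \<not> rainbow_free H2 (complete_graph (V t)) c"
  shows "\<exists>t. \<not> rainbow_free H1 (complete_graph (V t)) c"
  using assms unfolding rainbow_le_def by meson

lemma not_rainbow_freeE:
  assumes "\<not> rainbow_free H (complete_graph V) c"
  obtains S where "subgraph S (complete_graph V)" "simple_graph S" "S \<cong>\<^sub>g H" "inj_on c (edges S)"
  using assms unfolding rainbow_free_def rainbow_def subgraph_def by blast

lemma not_rainbow_freeI:
  assumes "S \<cong>\<^sub>g H" "inj_on c (edges S)" "finite (verts S)" "verts S \<subseteq> V"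
    and "\<And>e. e \<in> edges S \<Longrightarrow> e \<subseteq> verts S \<and> card e = 2"
  shows "\<not> rainbow_free H (complete_graph V) c"
proof -
  have "subgraph S (complete_graph V)"
    using assms(3-5) unfolding subgraph_def simple_graph_def complete_graph_def by force
  then show ?thesis
    using assms(1,2) unfolding rainbow_free_def rainbow_def by blast
qed

lemma doubleton_mem_complete_graph:
  "{x, y} \<in> edges (complete_graph V) \<longleftrightarrow> x \<in> V \<and> y \<in> V \<and> x \<noteq> y"
  unfolding complete_graph_def by (auto simp: card_2_iff doubleton_eq_iff)

lemma complete_graph_simple: "finite V \<Longrightarrow> simple_graph (complete_graph V)"
  unfolding complete_graph_def simple_graph_def by auto

text \<open>Edges of a rainbow copy that share a vertex have distinct colours, so the vertex playing
  \<open>w\<close> sees at least as many colours as \<open>w\<close> has edges. Both bounds on k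
  rest on this.\<close>

lemma rainbow_degree_le_colours:
  assumes "\<not> rainbow_free H (complete_graph V) c" "finite V" "w \<in> verts H"
  shows "\<exists>v\<in>V. card {e \<in> edges H. w \<in> e} \<le> card (c ` {e \<in> edges (complete_graph V). v \<in> e})"
proof -
  obtain S where S: "subgraph S (complete_graph V)" "simple_graph S" "S \<cong>\<^sub>g H" "inj_on c (edges S)"
    using not_rainbow_freeE[OF assms(1)] .
  obtain v where v: "v \<in> verts S" "card {e \<in> edges H. w \<in> e} \<le> card {e \<in> edges S. v \<in> e}"
    using graph_iso_degree_le[OF S(3,2) assms(3)] by blast
  have "card {e \<in> edges S. v \<in> e} = card (c ` {e \<in> edges S. v \<in> e})"
    using S(4) by (intro card_image[symmetric]) (auto simp: inj_on_def)
  also have "\<dots> \<le> card (c ` {e \<in> edges (complete_graph V). v \<in> e})"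
    using S(1) simple_graph_finite_edges[OF complete_graph_simple[OF assms(2)]]
    unfolding subgraph_def by (intro card_mono image_mono) auto
  finally have "card {e \<in> edges H. w \<in> e} \<le> card (c ` {e \<in> edges (complete_graph V). v \<in> e})"
    using v(2) by simp
  moreover have "v \<in> V" using S(1) v(1) unfolding subgraph_def complete_graph_def by auto
  ultimately show ?thesis by blast
qed

lemma rainbow_star_at_zero:
  fixes c :: "nat set \<Rightarrow> nat"
  assumes "inj_on (\<lambda>i. c {0, i}) {1..k}" "{0..k} \<subseteq> V"
  shows "\<not> rainbow_free (star_graph k) (complete_graph V) c"
proof (rule not_rainbow_freeI[OF graph_iso_refl])
  show "inj_on c (edges (star_graph k))"
    using assms(1) unfolding star_graph_edges by (intro inj_on_imageI) (simp add: comp_def)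
qed (use assms(2) in \<open>auto simp: star_graph_def\<close>)

text \<open>Edges at \<open>0\<close> alone supply both the rainbow star and arbitrarily many
  colours, so the colouring of the remaining edges may be chosen freely to restrict
  \<open>H\<close>.\<close>

lemma rainbow_of_star_rainbow_le:
  fixes c :: "nat set \<Rightarrow> nat"
  assumes "H \<le>\<^sub>r star_graph k" "\<And>i. c {0, i} = i"
  shows "\<exists>t. \<not> rainbow_free H (complete_graph {0..t + k}) c"
proof (rule rainbow_le_transfer[OF assms(1)])
  fix t
  have "{1..t} \<subseteq> c ` edges (complete_graph {0..t + k})"
  proof
    fix i assume "i \<in> {1..t}"
    then have "{0, i} \<in> edges (complete_graph {0..t + k})"
      by (simp add: doubleton_mem_complete_graph)
    then show "i \<in> c ` edges (complete_graph {0..t + k})" using assms(2) by (metis imageI)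
  qed
  then have "card {1..t} \<le> card (c ` edges (complete_graph {0..t + k}))"
    by (intro card_mono finite_imageI simple_graph_finite_edges complete_graph_simple) auto
  then show "t \<le> card (c ` edges (complete_graph {0..t + k}))" by simp
  show "\<not> rainbow_free (star_graph k) (complete_graph {0..t + k}) c"
    using assms(2) by (intro rainbow_star_at_zero) auto
qed simp

section \<open>Colourings that restrict rainbow subgraphs\<close>

lemma Max_colouring_no_rainbow_triangle:
  fixes S :: "nat graph"
  assumes "has_triangle S"
  shows "\<not> inj_on Max (edges S)"
proof
  assume inj: "inj_on Max (edges S)"
  obtain x y z where xyz: "x \<noteq> y" "y \<noteq> z" "x \<noteq> z"
    "{x, y} \<in> edges S" "{y, z} \<in> edges S" "{x, z} \<in> edges S"
    using assms unfolding has_triangle_def by blast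
  \<comment> \<open>The two edges meeting at the largest vertex of the triangle both receive that
    vertex as colour.\<close>
  have "Max {x, y} = Max {y, z} \<or> Max {y, z} = Max {x, z} \<or> Max {x, y} = Max {x, z}"
    by (auto simp: max_def)
  then show False
    using inj_on_eq_iff[OF inj] xyz by (metis doubleton_eq_iff)
qed

text \<open>For positive k, the star joins 0 to 1, ..., k - 1, and the matching consists of the
  pairs {2j, 2j + 1} with 2j at least k. Each such edge is coloured by its larger end, so these
  colours are distinct and positive; 0 is left for all other edges.\<close>

definition star_matching_colouring :: "nat \<Rightarrow> nat set \<Rightarrow> nat" where
  "star_matching_colouring k e =
     (if Min e = 0 \<and> Max e < k \<or> k \<le> Min e \<and> even (Min e) \<and> Max e = Suc (Min e)
      then Max e else 0)"

lemma star_matching_colouring_local: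
  assumes "finite V"
  shows "card (star_matching_colouring k ` {e \<in> edges (complete_graph V). v \<in> e}) \<le> max k 2"
proof -
  \<comment> \<open>\<open>Suc (2 * (v div 2))\<close> is the odd member of the pair containing
    \<open>v\<close>, hence the only matching colour possible at \<open>v\<close>. For k = 0 the
    vertex 0 belongs to the pair {0, 1} and falls under the last case.\<close>
  have col: "star_matching_colouring k e \<in> (if v = 0 \<and> 0 < k then {..<k} else if v < k then {0, v}
      else {0, Suc (2 * (v div 2))})"
    if e: "e \<in> edges (complete_graph V)" "v \<in> e" for e
  proof -
    obtain w where w: "e = {v, w}" "v \<noteq> w"
      using e(2) simple_graph_edgeE[OF complete_graph_simple[OF assms] e(1)]
      by (metis insertE insert_commute singletonD)
    show ?thesis
    proof (cases "v < w")
      case True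
      then have "Min e = v" "Max e = w" using w by auto
      then show ?thesis using w by (auto simp: star_matching_colouring_def)
    next
      case False
      then have "Min e = w" "Max e = v" using w by auto
      then show ?thesis using w by (auto simp: star_matching_colouring_def)
    qed
  qed
  have "card (star_matching_colouring k ` {e \<in> edges (complete_graph V). v \<in> e})
      \<le> card (if v = 0 \<and> 0 < k then {..<k} else if v < k then {0, v} else {0, Suc (2 * (v div 2))})"
    by (intro card_mono image_subsetI) (use col in simp_all)
  also have "\<dots> \<le> max k 2"
    by (simp add: card_insert_if max_def)
  finally show ?thesis .
qed

lemma star_matching_colouring_many_colours:
  "t \<le> card (star_matching_colouring k ` edges (complete_graph {..<2 * (k + t) + 2}))"
proof -
  \<comment> \<open>Starting at j = k guarantees that 2j is at least k. The extra 2 in the size of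
    the host leaves room for the star and the subdivided star even when t = 0.\<close>
  have "(\<lambda>j. Suc (2 * j)) ` {k..<k + t} \<subseteq>
      star_matching_colouring k ` edges (complete_graph {..<2 * (k + t) + 2})"
  proof (intro image_subsetI)
    fix j assume "j \<in> {k..<k + t}"
    then have "{2 * j, Suc (2 * j)} \<in> edges (complete_graph {..<2 * (k + t) + 2})"
      "star_matching_colouring k {2 * j, Suc (2 * j)} = Suc (2 * j)"
      by (auto simp: doubleton_mem_complete_graph star_matching_colouring_def)
    then show "Suc (2 * j) \<in>
        star_matching_colouring k ` edges (complete_graph {..<2 * (k + t) + 2})"
      by (metis imageI)
  qed
  then have "card ((\<lambda>j. Suc (2 * j)) ` {k..<k + t}) \<le>
      card (star_matching_colouring k ` edges (complete_graph {..<2 * (k + t) + 2}))"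
    by (intro card_mono finite_imageI simple_graph_finite_edges complete_graph_simple) auto
  then show ?thesis by (simp add: card_image inj_on_def)
qed

lemma star_matching_colouring_zero:
  "1 \<le> i \<Longrightarrow> star_matching_colouring k {0, i} = (if i < k \<or> k = 0 \<and> i = 1 then i else 0)"
  by (auto simp: star_matching_colouring_def)

text \<open>The edge from 0 to k has the common colour 0, which completes the k - 1 positive star
  colours to a rainbow star when k is positive.\<close>

lemma star_matching_colouring_star:
  "\<not> rainbow_free (star_graph k) (complete_graph {..<2 * (k + t) + 2}) (star_matching_colouring k)"
  by (rule rainbow_star_at_zero)
    (auto simp: inj_on_def star_matching_colouring_zero)

lemma star_matching_colouring_star_plus:
  assumes "1 \<le> k"
  shows "\<not> rainbow_free (star_plus_graph k) (complete_graph {..<2 * (k + t) + 2})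
    (star_matching_colouring k)"
proof -
  \<comment> \<open>The k-th edge at the centre goes, with colour 0, to the matching vertex
    \<open>2 * k\<close>, which is even and at least \<open>k\<close>. Its matching edge then
    extends the star with the new colour \<open>Suc (2 * k)\<close>.\<close>
  define S where "S = \<lparr>verts = {..<k} \<union> {2 * k, Suc (2 * k)},
    edges = (\<lambda>x. {0, x}) ` ({1..<k} \<union> {2 * k}) \<union> {{2 * k, Suc (2 * k)}}\<rparr>"
  have "card (verts S) - 2 = k"
    by (simp add: S_def card_Un_disjoint)
  moreover have "verts S - {0, Suc (2 * k)} = {1..<k} \<union> {2 * k}"
    using assms by (auto simp: S_def)
  ultimately have "S \<cong>\<^sub>g star_plus_graph k"
    using iso_star_plus_graphI[of S 0 "2 * k" "Suc (2 * k)"] assms by (simp add: S_def)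
  moreover have "star_matching_colouring k {2 * k, Suc (2 * k)} = Suc (2 * k)"
    by (simp add: star_matching_colouring_def)
  then have "inj_on (star_matching_colouring k) (edges S)"
    using assms by (auto simp: S_def inj_on_def star_matching_colouring_zero)
  ultimately show ?thesis
    by (rule not_rainbow_freeI) (use assms in \<open>auto simp: S_def\<close>)
qed

section \<open>Graphs between two stars\<close>

lemma rainbow_free_iso:
  assumes "H \<cong>\<^sub>g H'" "simple_graph H"
  shows "rainbow_free H G c \<longleftrightarrow> rainbow_free H' G c"
  unfolding rainbow_free_def
  using graph_iso_trans[OF _ assms(1)] graph_iso_trans[OF _ graph_iso_sym[OF assms]] by blast

lemma rainbow_le_star_imp_star_or_star_plus:
  assumes "simple_graph H" "connected_graph H" "H \<le>\<^sub>r star_graph k2"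
  shows "(\<exists>k. H \<cong>\<^sub>g star_graph k) \<or> (\<exists>k\<ge>1. H \<cong>\<^sub>g star_plus_graph k)"
proof -
  \<comment> \<open>On an edge at 0, \<open>Max e\<close> is the other end and positive, while edges
    off 0 share one colour. So a rainbow subgraph has at most one edge off 0.\<close>
  define c :: "nat set \<Rightarrow> nat" where "c = (\<lambda>e. if 0 \<in> e then Max e else 0)"
  obtain t where "\<not> rainbow_free H (complete_graph {0..t + k2}) c"
    using rainbow_of_star_rainbow_le[OF assms(3), of c] by (auto simp: c_def)
  then obtain S where S: "subgraph S (complete_graph {0..t + k2})" "simple_graph S"
      "S \<cong>\<^sub>g H" "inj_on c (edges S)"
    by (rule not_rainbow_freeE)
  have HS: "H \<cong>\<^sub>g S" using graph_iso_sym[OF S(3,2)] .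
  have "connected_graph S" using graph_iso_connected[OF HS assms(2)] .
  then have "(\<exists>k. S \<cong>\<^sub>g star_graph k) \<or> (\<exists>k\<ge>1. S \<cong>\<^sub>g star_plus_graph k) \<or> has_triangle S"
  proof (rule connected_one_edge_off_vertex[OF _ S(2)])
    fix e e' assume "e \<in> edges S" "e' \<in> edges S" "0 \<notin> e" "0 \<notin> e'"
    then show "e = e'" using S(4) by (auto simp: c_def inj_on_def)
  qed
  moreover have "\<not> has_triangle S"
  proof
    assume "has_triangle S"
    then have H: "has_triangle H" using graph_iso_has_triangle[OF S(3,2)] by blast
    \<comment> \<open>A triangle in \<open>S\<close> is one in \<open>H\<close>, hence in every copy
      of \<open>H\<close>, including the rainbow copy that the colouring by \<open>Max\<close> must
      contain.\<close>
    obtain t where "\<not> rainbow_free H (complete_graph {0..t + k2}) Max"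
      using rainbow_of_star_rainbow_le[OF assms(3), of Max] by auto
    then obtain T where T: "subgraph T (complete_graph {0..t + k2})" "simple_graph T"
        "T \<cong>\<^sub>g H" "inj_on Max (edges T)"
      by (rule not_rainbow_freeE)
    show False
      using graph_iso_has_triangle[OF graph_iso_sym[OF T(3,2)] assms(1) H]
        Max_colouring_no_rainbow_triangle T(4) by blast
  qed
  ultimately show ?thesis using graph_iso_trans[OF HS] by blast
qed

theorem theorem20:
  fixes H :: "'a graph" and k1 k2 :: nat
  assumes "in_H H"
    and "3 \<le> k1" and "k1 \<le> k2"
    and "star_graph k1 \<le>\<^sub>r H"
    and "H \<le>\<^sub>r star_graph k2"
  shows "\<exists>k. k1 \<le> k \<and> k \<le> k2 \<and> (H \<cong>\<^sub>g star_graph k \<or> H \<cong>\<^sub>g star_plus_graph k)"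
proof -
  have H: "simple_graph H" "connected_graph H" using assms(1) unfolding in_H_def by auto
  obtain k where k: "H \<cong>\<^sub>g star_graph k \<or> 1 \<le> k \<and> H \<cong>\<^sub>g star_plus_graph k"
    using rainbow_le_star_imp_star_or_star_plus[OF H assms(5)] by blast
  \<comment> \<open>In either case the centre 0 has degree \<open>k\<close>, so the bounds below
    need not distinguish the two shapes.\<close>
  obtain H' :: "nat graph" where
    H': "H \<cong>\<^sub>g H'" "0 \<in> verts H'" "card {e \<in> edges H'. 0 \<in> e} = k"
  proof -
    have "0 \<in> verts (star_graph k)" "0 \<in> verts (star_plus_graph k)"
      by (simp_all add: star_graph_def star_plus_graph_verts)
    then show thesis using that k star_graph_degree star_plus_graph_degree by blast
  qed
  \<comment> \<open>Colour with parameter \<open>k2\<close>: the star with \<open>k2\<close> leaves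
    is rainbow, hence so is a copy of \<open>H\<close>, whose centre needs \<open>k\<close> colours
    at one vertex.\<close>
  have "k \<le> k2"
  proof -
    obtain t where
      "\<not> rainbow_free H (complete_graph {..<2 * (k2 + t) + 2}) (star_matching_colouring k2)"
      using rainbow_le_transfer[OF assms(5), of "\<lambda>t. {..<2 * (k2 + t) + 2}"]
        star_matching_colouring_many_colours star_matching_colouring_star by blast
    then have "\<not> rainbow_free H' (complete_graph {..<2 * (k2 + t) + 2}) (star_matching_colouring k2)"
      using rainbow_free_iso[OF H'(1) H(1)] by blast
    from rainbow_degree_le_colours[OF this finite_lessThan H'(2)]
    obtain v where "k \<le> card (star_matching_colouring k2 `
        {e \<in> edges (complete_graph {..<2 * (k2 + t) + 2}). v \<in> e})"
      unfolding H'(3) by blast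
    also have "\<dots> \<le> max k2 2" by (simp add: star_matching_colouring_local)
    finally show ?thesis using assms(2,3) by simp
  qed
  \<comment> \<open>The roles are exchanged: with parameter \<open>k\<close> the graph
    \<open>H\<close> has a rainbow copy, which forces a rainbow star with \<open>k1\<close> leaves.
    As \<open>k1\<close> is at least 3, its centre cannot be a vertex seeing only two
    colours.\<close>
  moreover have "k1 \<le> k"
  proof -
    have "\<not> rainbow_free H (complete_graph {..<2 * (k + t) + 2}) (star_matching_colouring k)" for t
      using k rainbow_free_iso[OF _ H(1)] star_matching_colouring_star
        star_matching_colouring_star_plus by blast
    then obtain t where "\<not> rainbow_free (star_graph k1) (complete_graph {..<2 * (k + t) + 2})
        (star_matching_colouring k)"
      using rainbow_le_transfer[OF assms(4), of "\<lambda>t. {..<2 * (k + t) + 2}"]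
        star_matching_colouring_many_colours by blast
    moreover have "0 \<in> verts (star_graph k1)" by (simp add: star_graph_def)
    ultimately obtain v where "k1 \<le> card (star_matching_colouring k `
        {e \<in> edges (complete_graph {..<2 * (k + t) + 2}). v \<in> e})"
      using rainbow_degree_le_colours[of "star_graph k1" _ _ 0] star_graph_degree[of k1]
        finite_lessThan by metis
    also have "\<dots> \<le> max k 2" by (simp add: star_matching_colouring_local)
    finally show ?thesis using assms(2) by simp
  qed
  ultimately show ?thesis using k by blast
qed

end
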